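(* Suppose that $A\in B(H,H_o)$ is a frame generator for a unitary system $\mathscr U$ on $H$ for which $\theta_A\theta_A^*=I$. Then an operator $B\in B(H,H_o)$ is a Parseval frame generator for $\mathscr U$ if and only if $B=AV^*$ for some co-isometry $V\in B(H)$ such that $(VU-UV)A^*=0$ for every $U\in\mathscr U$. If $B=AV^*$ for such a co-isometry, then $V=\theta_B^*\theta_A$.
   Context: $H,H_o$ are Hilbert spaces. A unitary system $\mathscr U$ on $H$ is a collection of unitary operators on $H$ that includes the identity. A family $\{A_j\}_{j\in\mathbb J}\subset B(H,H_o)$ is an operator-valued frame if $\sum_jA_j^*A_j$ converges in the strong operator topology (net of finite partial sums) to a bounded positive invertible operator; it is Parseval if the sum is $I$. $A\in B(H,H_o)$ is an operator frame generator (resp. Parseval frame generator) for $\mathscr U$ if $\{AU^*\}_{U\in\mathscr U}$ is an operator-valued frame (resp. a Parseval one). For such $A$ the analysis operator is $\theta_A:=\sum_{U\in\mathscr U}L_UAU^*\in B(H,\ell^2(\mathscr U)\otimes H_o)$ (strong convergence), where $L_Uh=e_U\otimes h$ for $h\in H_o$ and $\{e_U\}_{U\in\mathscr U}$ is the standard basis of $\ell^2(\mathscr U)$. In the condition $\theta_A\theta_A^*=I$, $I$ is the identity of $\ell^2(\mathscr U)\otimes H_o$. A co-isometry is an operator $V$ with $VV^*=I$. *)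

theory Defs
  imports "HOL-Analysis.Analysis"
begin

section \<open>Complex Hilbert spaces\<close>

text \<open>
  The class extends the real inner product spaces of the library, so that norm, topology,
  summation and completeness are inherited; the real inner product is the real part of the
  complex one.  The complex inner product is linear in its first argument.
\<close>

class complex_inner = real_inner +
  fixes scaleC :: "complex \<Rightarrow> 'a \<Rightarrow> 'a" (infixr "*\<^sub>C" 75)
    and cinner :: "'a \<Rightarrow> 'a \<Rightarrow> complex"
  assumes scaleC_add_right: "a *\<^sub>C (x + y) = a *\<^sub>C x + a *\<^sub>C y"
    and scaleC_add_left: "(a + b) *\<^sub>C x = a *\<^sub>C x + b *\<^sub>C x"
    and scaleC_scaleC: "a *\<^sub>C (b *\<^sub>C x) = (a * b) *\<^sub>C x"
    and scaleC_of_real: "complex_of_real r *\<^sub>C x = r *\<^sub>R x"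
    and cinner_commute: "cinner x y = cnj (cinner y x)"
    and cinner_add_left: "cinner (x + y) z = cinner x z + cinner y z"
    and cinner_scaleC_left: "cinner (a *\<^sub>C x) y = a * cinner x y"
    and inner_eq_Re_cinner: "inner x y = Re (cinner x y)"

class chilbert_space = complex_inner + complete_space

lemma cinner_scaleC_right: "cinner x (a *\<^sub>C y) = cnj a * cinner x y"
  for x :: "'a::complex_inner"
  by (metis cinner_commute cinner_scaleC_left complex_cnj_mult)

lemma cinner_self: "cinner x x = complex_of_real ((norm x)\<^sup>2)" for x :: "'a::complex_inner"
proof (rule complex_eqI)
  show "Re (cinner x x) = Re (complex_of_real ((norm x)\<^sup>2))"
    by (simp add: inner_eq_Re_cinner [symmetric] power2_norm_eq_inner)
  have "Im (cinner x x) = - Im (cinner x x)"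
    by (metis cinner_commute cnj.simps(2))
  then show "Im (cinner x x) = Im (complex_of_real ((norm x)\<^sup>2))"
    by simp
qed

lemma norm_scaleC: "norm (a *\<^sub>C x) = cmod a * norm x" for x :: "'a::complex_inner"
proof -
  have "complex_of_real ((norm (a *\<^sub>C x))\<^sup>2) = complex_of_real ((cmod a * norm x)\<^sup>2)"
    by (simp add: cinner_self [symmetric] cinner_scaleC_left cinner_scaleC_right
        power_mult_distrib complex_norm_square mult.assoc del: of_real_power)
  then have "(norm (a *\<^sub>C x))\<^sup>2 = (cmod a * norm x)\<^sup>2"
    using of_real_eq_iff by blast
  then show ?thesis
    by (simp add: power2_eq_iff_nonneg)
qed

lemma Im_cinner: "Im (cinner x y) = inner x (\<i> *\<^sub>C y)" for x :: "'a::complex_inner"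
  by (simp add: inner_eq_Re_cinner cinner_scaleC_right)

lemma scaleC_scaleR: "a *\<^sub>C (r *\<^sub>R x) = r *\<^sub>R (a *\<^sub>C x)" for x :: "'a::complex_inner"
  by (metis mult.commute scaleC_of_real scaleC_scaleC)

instantiation complex :: chilbert_space
begin

definition scaleC_complex :: "complex \<Rightarrow> complex \<Rightarrow> complex"
  where "scaleC_complex = (*)"

definition cinner_complex :: "complex \<Rightarrow> complex \<Rightarrow> complex"
  where "cinner_complex x y = x * cnj y"

instance
  by standard (auto simp: scaleC_complex_def cinner_complex_def inner_complex_def algebra_simps
      scaleR_conv_of_real)

end


section \<open>Bounded operators\<close>

definition bounded_clinear :: "('a::complex_inner \<Rightarrow> 'b::complex_inner) \<Rightarrow> bool"
  where "bounded_clinear T \<longleftrightarrow> bounded_linear T \<and> (\<forall>c x. T (c *\<^sub>C x) = c *\<^sub>C T x)"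

text \<open>
  The Hilbert space adjoint; meaningful for bounded complex-linear operators
  between Hilbert spaces.
\<close>

definition cadjoint :: "('a::complex_inner \<Rightarrow> 'b::complex_inner) \<Rightarrow> 'b \<Rightarrow> 'a"
  where "cadjoint T = (THE S. \<forall>x y. cinner (T x) y = cinner x (S y))"

lemma cadjoint_eqI:
  fixes T :: "'a::complex_inner \<Rightarrow> 'b::complex_inner"
  assumes "\<And>x y. cinner (T x) y = cinner x (S y)"
  shows "cadjoint T = S"
  unfolding cadjoint_def
proof (rule the_equality)
  fix R assume R: "\<forall>x y. cinner (T x) y = cinner x (R y)"
  show "R = S"
  proof
    fix y
    have "inner x (R y) = inner x (S y)" for x
      using assms R by (simp add: inner_eq_Re_cinner)
    then show "R y = S y"
      by (metis vector_eq_ldot)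
  qed
qed (use assms in auto)

definition unitary_op :: "('a::complex_inner \<Rightarrow> 'a) \<Rightarrow> bool"
  where "unitary_op U \<longleftrightarrow> bounded_clinear U \<and> cadjoint U \<circ> U = id \<and> U \<circ> cadjoint U = id"

definition coisometry :: "('a::complex_inner \<Rightarrow> 'a) \<Rightarrow> bool"
  where "coisometry V \<longleftrightarrow> bounded_clinear V \<and> V \<circ> cadjoint V = id"

definition positive_op :: "('a::complex_inner \<Rightarrow> 'a) \<Rightarrow> bool"
  where "positive_op S \<longleftrightarrow>
    bounded_clinear S \<and> (\<forall>x. Im (cinner (S x) x) = 0 \<and> 0 \<le> Re (cinner (S x) x))"

definition invertible_op :: "('a::complex_inner \<Rightarrow> 'a) \<Rightarrow> bool"
  where "invertible_op S \<longleftrightarrow>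
    bounded_clinear S \<and> (\<exists>R. bounded_clinear R \<and> R \<circ> S = id \<and> S \<circ> R = id)"

text \<open>Convergence of the net of finite partial sums in the strong operator topology.\<close>

definition has_sot_sum :: "('j \<Rightarrow> 'a::complex_inner \<Rightarrow> 'b::complex_inner) \<Rightarrow> ('a \<Rightarrow> 'b) \<Rightarrow> 'j set \<Rightarrow> bool"
  where "has_sot_sum T S J \<longleftrightarrow> (\<forall>x. ((\<lambda>j. T j x) has_sum S x) J)"


section \<open>Square-summable families\<close>

lemma ell2_summableI:
  fixes f :: "'i \<Rightarrow> 'k::complex_inner"
  assumes "\<And>F. finite F \<Longrightarrow> (\<Sum>i\<in>F. (norm (f i))\<^sup>2) \<le> b"
  shows "(\<lambda>i. (norm (f i))\<^sup>2) summable_on UNIV"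
  by (rule nonneg_bounded_partial_sums_imp_summable_on [where C = b])
     (use assms in \<open>auto simp: eventually_finite_subsets_at_top\<close>)

lemma ell2_inner_summable:
  fixes f g :: "'i \<Rightarrow> 'k::complex_inner"
  assumes "(\<lambda>i. (norm (f i))\<^sup>2) summable_on UNIV" "(\<lambda>i. (norm (g i))\<^sup>2) summable_on UNIV"
  shows "(\<lambda>i. inner (f i) (g i)) summable_on UNIV"
proof -
  have "(\<lambda>i. norm (inner (f i) (g i))) summable_on UNIV"
  proof (rule summable_on_comparison_test)
    show "(\<lambda>i. (norm (f i))\<^sup>2 + (norm (g i))\<^sup>2) summable_on UNIV"
      using assms by (rule summable_on_add)
    fix i
    have "norm (inner (f i) (g i)) \<le> norm (f i) * norm (g i)"
      by (simp add: Cauchy_Schwarz_ineq2)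
    also have "\<dots> \<le> (norm (f i))\<^sup>2 + (norm (g i))\<^sup>2"
      using sum_squares_bound [of "norm (f i)" "norm (g i)"]
        mult_nonneg_nonneg [OF norm_ge_zero [of "f i"] norm_ge_zero [of "g i"]]
      by linarith
    finally show "norm (inner (f i) (g i)) \<le> (norm (f i))\<^sup>2 + (norm (g i))\<^sup>2" .
  qed auto
  then show ?thesis
    by (rule abs_summable_summable)
qed

lemma ell2_add_summable:
  fixes f g :: "'i \<Rightarrow> 'k::complex_inner"
  assumes f: "(\<lambda>i. (norm (f i))\<^sup>2) summable_on UNIV" and g: "(\<lambda>i. (norm (g i))\<^sup>2) summable_on UNIV"
  shows "(\<lambda>i. (norm (f i + g i))\<^sup>2) summable_on UNIV"
proof -
  have "(\<lambda>i. (norm (f i))\<^sup>2 + 2 * inner (f i) (g i) + (norm (g i))\<^sup>2) summable_on UNIV"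
    by (intro summable_on_add summable_on_cmult_right ell2_inner_summable f g)
  then show ?thesis
    by (rule summable_on_cong [THEN iffD1, rotated])
       (simp add: power2_norm_eq_inner inner_add_left inner_add_right inner_commute)
qed

text \<open>\<open>\<ell>\<^sup>2(I; K)\<close> for the whole index type \<open>I\<close>, with the case \<open>K = \<complex>\<close> giving \<open>\<ell>\<^sup>2(I)\<close>.\<close>

typedef (overloaded) ('i, 'k::complex_inner) ell2 =
  "{f :: 'i \<Rightarrow> 'k. (\<lambda>i. (norm (f i))\<^sup>2) summable_on UNIV}"
  morphisms ell2_apply Abs_ell2
  by (rule exI [where x = "\<lambda>_. 0"]) simp

setup_lifting type_definition_ell2

lemma ell2_apply_summable: "(\<lambda>i. (norm (ell2_apply x i))\<^sup>2) summable_on UNIV"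
  using ell2_apply by blast

lemma ell2_eqI: "(\<And>i. ell2_apply x i = ell2_apply y i) \<Longrightarrow> x = y"
  by (metis ell2_apply_inject ext)

instantiation ell2 :: (type, complex_inner) complex_inner
begin

lift_definition zero_ell2 :: "('a, 'b) ell2" is "\<lambda>_. 0"
  by simp

lift_definition plus_ell2 :: "('a, 'b) ell2 \<Rightarrow> ('a, 'b) ell2 \<Rightarrow> ('a, 'b) ell2"
  is "\<lambda>f g i. f i + g i"
  by (rule ell2_add_summable)

lift_definition uminus_ell2 :: "('a, 'b) ell2 \<Rightarrow> ('a, 'b) ell2" is "\<lambda>f i. - f i"
  by simp

lift_definition minus_ell2 :: "('a, 'b) ell2 \<Rightarrow> ('a, 'b) ell2 \<Rightarrow> ('a, 'b) ell2"
  is "\<lambda>f g i. f i - g i"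
  subgoal for f g
    using ell2_add_summable [of f "\<lambda>i. - g i"] by simp
  done

lift_definition scaleR_ell2 :: "real \<Rightarrow> ('a, 'b) ell2 \<Rightarrow> ('a, 'b) ell2" is "\<lambda>r f i. r *\<^sub>R f i"
  by (simp add: power_mult_distrib summable_on_cmult_right)

lift_definition scaleC_ell2 :: "complex \<Rightarrow> ('a, 'b) ell2 \<Rightarrow> ('a, 'b) ell2" is "\<lambda>c f i. c *\<^sub>C f i"
  by (simp add: norm_scaleC power_mult_distrib summable_on_cmult_right)

lift_definition cinner_ell2 :: "('a, 'b) ell2 \<Rightarrow> ('a, 'b) ell2 \<Rightarrow> complex"
  is "\<lambda>f g. \<Sum>\<^sub>\<infinity>i. cinner (f i) (g i)" .

lift_definition inner_ell2 :: "('a, 'b) ell2 \<Rightarrow> ('a, 'b) ell2 \<Rightarrow> real"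
  is "\<lambda>f g. \<Sum>\<^sub>\<infinity>i. inner (f i) (g i)" .

definition norm_ell2 :: "('a, 'b) ell2 \<Rightarrow> real"
  where "norm_ell2 x = sqrt (inner x x)"

definition dist_ell2 :: "('a, 'b) ell2 \<Rightarrow> ('a, 'b) ell2 \<Rightarrow> real"
  where "dist_ell2 x y = norm (x - y)"

definition sgn_ell2 :: "('a, 'b) ell2 \<Rightarrow> ('a, 'b) ell2"
  where "sgn_ell2 x = inverse (norm x) *\<^sub>R x"

definition uniformity_ell2 :: "(('a, 'b) ell2 \<times> ('a, 'b) ell2) filter"
  where "uniformity_ell2 = (INF e\<in>{0 <..}. principal {(x, y). dist x y < e})"

definition open_ell2 :: "('a, 'b) ell2 set \<Rightarrow> bool"
  where "open_ell2 S = (\<forall>x\<in>S. \<forall>\<^sub>F (x', y) in uniformity. x' = x \<longrightarrow> y \<in> S)"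

lemma ell2_cinner_summable:
  fixes x y :: "('a, 'b) ell2"
  shows "(\<lambda>i. cinner (ell2_apply x i) (ell2_apply y i)) summable_on UNIV"
proof -
  have "(\<lambda>i. complex_of_real (inner (ell2_apply x i) (ell2_apply y i))
          + \<i> * complex_of_real (inner (ell2_apply x i) (ell2_apply (\<i> *\<^sub>C y) i))) summable_on UNIV"
    by (intro summable_on_add summable_on_cmult_right summable_on_of_real
        ell2_inner_summable ell2_apply_summable)
  then show ?thesis
    by (rule summable_on_cong [THEN iffD1, rotated])
       (auto simp: complex_eq_iff scaleC_ell2.rep_eq Im_cinner inner_eq_Re_cinner)
qed

instance
proof
  fix x y z :: "('a, 'b) ell2" and a b :: real and c d :: complex
  note rep = zero_ell2.rep_eq plus_ell2.rep_eq uminus_ell2.rep_eq minus_ell2.rep_eq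
    scaleR_ell2.rep_eq scaleC_ell2.rep_eq
  note summ = ell2_inner_summable [OF ell2_apply_summable ell2_apply_summable]
  show "x + y + z = x + (y + z)" "x + y = y + x" "0 + x = x" "- x + x = 0" "x - y = x + - y"
    by (rule ell2_eqI; simp add: rep algebra_simps)+
  show "a *\<^sub>R (x + y) = a *\<^sub>R x + a *\<^sub>R y" "(a + b) *\<^sub>R x = a *\<^sub>R x + b *\<^sub>R x"
    "a *\<^sub>R b *\<^sub>R x = (a * b) *\<^sub>R x" "1 *\<^sub>R x = x"
    by (rule ell2_eqI; simp add: rep algebra_simps)+
  show "sgn x = inverse (norm x) *\<^sub>R x" "dist x y = norm (x - y)" "norm x = sqrt (inner x x)"
    by (simp_all add: sgn_ell2_def dist_ell2_def norm_ell2_def)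
  show "uniformity = (INF e\<in>{0<..}. principal {(x, y :: ('a, 'b) ell2). dist x y < e})"
    by (rule uniformity_ell2_def)
  show "open S = (\<forall>x\<in>S. \<forall>\<^sub>F (x', y) in uniformity. x' = x \<longrightarrow> y \<in> S)" for S :: "('a, 'b) ell2 set"
    by (rule open_ell2_def)
  show "inner x y = inner y x"
    by (simp add: inner_ell2.rep_eq inner_commute)
  show "inner (x + y) z = inner x z + inner y z"
    by (simp add: inner_ell2.rep_eq rep inner_add_left infsum_add summ)
  show "inner (a *\<^sub>R x) y = a * inner x y"
    by (simp add: inner_ell2.rep_eq rep infsum_cmult_right')
  show "0 \<le> inner x x"
    by (simp add: inner_ell2.rep_eq infsum_nonneg)
  show "inner x x = 0 \<longleftrightarrow> x = 0"
  proof
    assume 0: "inner x x = 0"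
    show "x = 0"
    proof (rule ell2_eqI)
      fix i
      have "inner (ell2_apply x i) (ell2_apply x i) = 0"
        by (rule nonneg_infsum_le_0D [where A = UNIV])
           (use 0 summ in \<open>auto simp: inner_ell2.rep_eq\<close>)
      then show "ell2_apply x i = ell2_apply 0 i"
        by (simp add: rep)
    qed
  qed (simp add: inner_ell2.rep_eq rep)
  show "c *\<^sub>C (x + y) = c *\<^sub>C x + c *\<^sub>C y" "(c + d) *\<^sub>C x = c *\<^sub>C x + d *\<^sub>C x"
    "c *\<^sub>C (d *\<^sub>C x) = (c * d) *\<^sub>C x" "complex_of_real a *\<^sub>C x = a *\<^sub>R x"
    by (rule ell2_eqI; simp add: rep scaleC_add_right scaleC_add_left scaleC_scaleC scaleC_of_real)+
  show "cinner x y = cnj (cinner y x)"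
    by (simp add: cinner_ell2.rep_eq flip: infsum_cnj cinner_commute)
  show "cinner (x + y) z = cinner x z + cinner y z"
    by (simp add: cinner_ell2.rep_eq rep cinner_add_left infsum_add ell2_cinner_summable)
  show "cinner (c *\<^sub>C x) y = c * cinner x y"
    by (simp add: cinner_ell2.rep_eq rep cinner_scaleC_left infsum_cmult_right')
  show "inner x y = Re (cinner x y)"
    by (simp add: cinner_ell2.rep_eq inner_ell2.rep_eq inner_eq_Re_cinner infsum_Re
        ell2_cinner_summable)
qed

end

lemma norm_ell2_sq: "(norm x)\<^sup>2 = (\<Sum>\<^sub>\<infinity>i. (norm (ell2_apply x i))\<^sup>2)"
  by (simp add: power2_norm_eq_inner inner_ell2.rep_eq)

lemma ell2_partial_sum_le:
  assumes "finite F"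
  shows "(\<Sum>i\<in>F. (norm (ell2_apply x i))\<^sup>2) \<le> (norm x)\<^sup>2"
  unfolding norm_ell2_sq
  by (rule finite_sum_le_infsum) (use assms ell2_apply_summable in auto)

lemma norm_ell2_apply_le: "norm (ell2_apply x i) \<le> norm x"
  using ell2_partial_sum_le [of "{i}" x] by (simp add: power2_le_iff_abs_le)

instance ell2 :: (type, chilbert_space) chilbert_space
proof
  fix X :: "nat \<Rightarrow> ('a, 'b) ell2"
  assume X: "Cauchy X"
  have "Cauchy (\<lambda>n. ell2_apply (X n) i)" for i
  proof (rule metric_CauchyI)
    fix e :: real assume "e > 0"
    then obtain N where N: "\<And>m n. m \<ge> N \<Longrightarrow> n \<ge> N \<Longrightarrow> dist (X m) (X n) < e"
      using X unfolding Cauchy_def by blast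
    have "dist (ell2_apply (X m) i) (ell2_apply (X n) i) < e" if "m \<ge> N" "n \<ge> N" for m n
      using norm_ell2_apply_le [of "X m - X n" i] N [OF that]
      by (simp add: dist_norm minus_ell2.rep_eq)
    then show "\<exists>N. \<forall>m\<ge>N. \<forall>n\<ge>N. dist (ell2_apply (X m) i) (ell2_apply (X n) i) < e"
      by blast
  qed
  then have "\<forall>i. \<exists>l. (\<lambda>n. ell2_apply (X n) i) \<longlonglongrightarrow> l"
    by (meson Cauchy_convergent convergentD)
  then obtain f where f: "\<And>i. (\<lambda>n. ell2_apply (X n) i) \<longlonglongrightarrow> f i"
    by metis
  have bd: "(\<Sum>i\<in>F. (norm (f i - ell2_apply (X n) i))\<^sup>2) \<le> e\<^sup>2"
    if "\<And>m. m \<ge> N \<Longrightarrow> dist (X m) (X n) < e" "finite F" for N n e F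
  proof (rule tendsto_upperbound)
    show "(\<lambda>m. \<Sum>i\<in>F. (norm (ell2_apply (X m) i - ell2_apply (X n) i))\<^sup>2)
            \<longlonglongrightarrow> (\<Sum>i\<in>F. (norm (f i - ell2_apply (X n) i))\<^sup>2)"
      by (intro tendsto_intros f)
    show "\<forall>\<^sub>F m in sequentially.
            (\<Sum>i\<in>F. (norm (ell2_apply (X m) i - ell2_apply (X n) i))\<^sup>2) \<le> e\<^sup>2"
      using eventually_ge_at_top [of N]
    proof eventually_elim
      case (elim m)
      have "(\<Sum>i\<in>F. (norm (ell2_apply (X m) i - ell2_apply (X n) i))\<^sup>2) \<le> (norm (X m - X n))\<^sup>2"
        using ell2_partial_sum_le [OF that(2), of "X m - X n"] by (simp add: minus_ell2.rep_eq)
      also have "\<dots> \<le> e\<^sup>2"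
        using that(1) [OF elim] by (intro power_mono) (auto simp: dist_norm)
      finally show ?case .
    qed
  qed simp
  have tail: "(\<lambda>i. (norm (f i - ell2_apply (X n) i))\<^sup>2) summable_on UNIV"
    if "\<And>m. m \<ge> N \<Longrightarrow> dist (X m) (X n) < e" for N n e
    using bd [OF that] by (rule ell2_summableI)
  obtain N1 where "\<And>m n. m \<ge> N1 \<Longrightarrow> n \<ge> N1 \<Longrightarrow> dist (X m) (X n) < 1"
    using X unfolding Cauchy_def by (meson zero_less_one)
  then have "(\<lambda>i. (norm (f i - ell2_apply (X N1) i + ell2_apply (X N1) i))\<^sup>2) summable_on UNIV"
    by (intro ell2_add_summable tail [of N1 N1 1] ell2_apply_summable) auto
  then have "f \<in> {f. (\<lambda>i. (norm (f i))\<^sup>2) summable_on UNIV}"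
    by simp
  then have app: "ell2_apply (Abs_ell2 f) = f"
    by (rule Abs_ell2_inverse)
  have "X \<longlonglongrightarrow> Abs_ell2 f"
  proof (rule metric_LIMSEQ_I)
    fix r :: real assume "r > 0"
    then obtain N where N: "\<And>m n. m \<ge> N \<Longrightarrow> n \<ge> N \<Longrightarrow> dist (X m) (X n) < r / 2"
      using X unfolding Cauchy_def by (meson half_gt_zero)
    have "dist (X n) (Abs_ell2 f) < r" if n: "n \<ge> N" for n
    proof -
      have *: "\<And>m. m \<ge> N \<Longrightarrow> dist (X m) (X n) < r / 2"
        using N n by blast
      have "(norm (Abs_ell2 f - X n))\<^sup>2 \<le> (r / 2)\<^sup>2"
        unfolding norm_ell2_sq minus_ell2.rep_eq app
        by (rule infsum_le_finite_sums [OF tail [OF *]]) (use bd [OF *] in auto)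
      then have "norm (Abs_ell2 f - X n) \<le> r / 2"
        using \<open>r > 0\<close> by (simp add: power2_le_iff_abs_le)
      then show ?thesis
        using \<open>r > 0\<close> by (simp add: dist_norm norm_minus_commute)
    qed
    then show "\<exists>N. \<forall>n\<ge>N. dist (X n) (Abs_ell2 f) < r"
      by blast
  qed
  then show "convergent X"
    by (rule convergentI)
qed


section \<open>The tensor product of \<open>\<ell>\<^sup>2(I)\<close> with a Hilbert space\<close>

lift_definition tensor :: "('i, complex) ell2 \<Rightarrow> 'k::complex_inner \<Rightarrow> ('i, 'k) ell2" (infixr "\<otimes>\<^sub>2" 70)
  is "\<lambda>a h i. a i *\<^sub>C h"
  by (simp add: norm_scaleC power_mult_distrib summable_on_cmult_left)

lift_definition basis_ell2 :: "'i \<Rightarrow> ('i, complex) ell2" is "\<lambda>i j. if j = i then 1 else 0"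
  subgoal for i
    by (rule finite_nonzero_values_imp_summable_on) (rule finite_subset [of _ "{i}"]; auto)
  done

definition ell2_on :: "'i set \<Rightarrow> ('i, complex) ell2 set"
  where "ell2_on I = {a. \<forall>i. i \<notin> I \<longrightarrow> ell2_apply a i = 0}"

text \<open>
  For a set \<open>I\<close> of indices, \<open>\<ell>\<^sup>2(I) \<otimes> K\<close> is the closed linear span of the elementary tensors
  \<open>a \<otimes> h\<close> with \<open>a \<in> \<ell>\<^sup>2(I)\<close> inside the \<open>K\<close>-valued square-summable families; as the elementary
  tensors are closed under complex scalars, their real span is already the complex span.
  Lemma \<open>cinner_tensor\<close> shows that the inner product is that of the Hilbert space tensor product,
  and \<open>ell2_tensor_eq\<close> that the space consists of all families supported in \<open>I\<close>.
\<close>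

definition ell2_tensor :: "'i set \<Rightarrow> ('i, 'k::complex_inner) ell2 set"
  where "ell2_tensor I = closure (span {a \<otimes>\<^sub>2 h | a h. a \<in> ell2_on I})"

lemma cinner_tensor: "cinner (a \<otimes>\<^sub>2 h) (b \<otimes>\<^sub>2 k) = cinner a b * cinner h k"
proof -
  have "cinner (a \<otimes>\<^sub>2 h) (b \<otimes>\<^sub>2 k)
      = (\<Sum>\<^sub>\<infinity>i. cinner (ell2_apply a i) (ell2_apply b i) * cinner h k)"
    unfolding cinner_ell2.rep_eq tensor.rep_eq
    by (rule infsum_cong)
       (simp add: cinner_scaleC_left cinner_scaleC_right cinner_complex_def)
  then show ?thesis
    by (simp add: infsum_cmult_left' cinner_ell2.rep_eq)
qed

lemma ell2_apply_sum: "ell2_apply (sum f F) i = (\<Sum>j\<in>F. ell2_apply (f j) i)"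
  by (induction F rule: infinite_finite_induct) (auto simp: zero_ell2.rep_eq plus_ell2.rep_eq)

lemma scaleC_1 [simp]: "1 *\<^sub>C x = x" and scaleC_0 [simp]: "0 *\<^sub>C x = 0" for x :: "'a::complex_inner"
  using scaleC_of_real [of 1 x] scaleC_of_real [of 0 x] by simp_all

lemma bounded_linear_ell2_apply: "bounded_linear (\<lambda>x. ell2_apply x i)"
  by (rule bounded_linear_intro [where K = 1])
     (auto simp: plus_ell2.rep_eq scaleR_ell2.rep_eq norm_ell2_apply_le)

lemma ell2_apply_basis_sum:
  assumes "finite F"
  shows "ell2_apply (\<Sum>i\<in>F. basis_ell2 i \<otimes>\<^sub>2 ell2_apply x i) j = (if j \<in> F then ell2_apply x j else 0)"
proof -
  have "ell2_apply (\<Sum>i\<in>F. basis_ell2 i \<otimes>\<^sub>2 ell2_apply x i) j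
      = (\<Sum>i\<in>F. if j = i then ell2_apply x i else 0)"
    unfolding ell2_apply_sum tensor.rep_eq basis_ell2.rep_eq by (intro sum.cong) auto
  also have "\<dots> = (if j \<in> F then ell2_apply x j else 0)"
    using assms by simp
  finally show ?thesis .
qed

lemma ell2_tensor_eq:
  "ell2_tensor I = {x :: ('i, 'k::complex_inner) ell2. \<forall>i. i \<notin> I \<longrightarrow> ell2_apply x i = 0}"
proof (rule set_eqI, rule iffI)
  fix x :: "('i, 'k) ell2"
  let ?S = "{x :: ('i, 'k) ell2. \<forall>i. i \<notin> I \<longrightarrow> ell2_apply x i = 0}"
  have "?S = (\<Inter>i\<in>- I. {x. ell2_apply x i = 0})"
    by auto
  moreover have "closed {x :: ('i, 'k) ell2. ell2_apply x i = 0}" for i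
    by (intro closed_Collect_eq continuous_intros
        bounded_linear.continuous_on [OF bounded_linear_ell2_apply])
  ultimately have "closed ?S"
    by auto
  moreover have "subspace ?S"
    by (auto simp: subspace_def zero_ell2.rep_eq plus_ell2.rep_eq scaleR_ell2.rep_eq)
  moreover have "{a \<otimes>\<^sub>2 h | a h. a \<in> ell2_on I} \<subseteq> ?S"
    by (auto simp: ell2_on_def tensor.rep_eq)
  ultimately have "ell2_tensor I \<subseteq> ?S"
    unfolding ell2_tensor_def by (intro closure_minimal span_minimal)
  then show "x \<in> ?S" if "x \<in> ell2_tensor I"
    using that by blast
next
  fix x :: "('i, 'k) ell2"
  assume x: "x \<in> {x. \<forall>i. i \<notin> I \<longrightarrow> ell2_apply x i = 0}"
  show "x \<in> ell2_tensor I"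
    unfolding ell2_tensor_def closure_approachable
  proof (intro allI impI)
    fix e :: real assume e: "e > 0"
    have "((\<lambda>i. (norm (ell2_apply x i))\<^sup>2) has_sum (norm x)\<^sup>2) UNIV"
      unfolding norm_ell2_sq using ell2_apply_summable by (rule has_sum_infsum)
    then obtain F where F: "finite F"
      "dist (\<Sum>i\<in>F. (norm (ell2_apply x i))\<^sup>2) ((norm x)\<^sup>2) \<le> e\<^sup>2 / 2"
      using has_sum_finite_approximation [where A = UNIV and \<epsilon> = "e\<^sup>2 / 2"] e
      by (metis half_gt_zero zero_less_power)
    define y where "y = (\<Sum>i\<in>F \<inter> I. basis_ell2 i \<otimes>\<^sub>2 ell2_apply x i)"
    have y: "ell2_apply y j = (if j \<in> F then ell2_apply x j else 0)" for j
      using x F(1) unfolding y_def by (subst ell2_apply_basis_sum) auto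
    have "(norm (x - y))\<^sup>2 = (\<Sum>\<^sub>\<infinity>i\<in>- F. (norm (ell2_apply x i))\<^sup>2)"
      unfolding norm_ell2_sq by (rule infsum_cong_neutral) (auto simp: minus_ell2.rep_eq y)
    moreover have "(norm x)\<^sup>2 = (\<Sum>i\<in>F. (norm (ell2_apply x i))\<^sup>2)
        + (\<Sum>\<^sub>\<infinity>i\<in>- F. (norm (ell2_apply x i))\<^sup>2)"
      using infsum_Un_disjoint [of "\<lambda>i. (norm (ell2_apply x i))\<^sup>2" F "- F"] F(1)
        summable_on_subset_banach [OF ell2_apply_summable, of "- F" x]
      by (simp add: norm_ell2_sq)
    ultimately have "(norm (x - y))\<^sup>2 \<le> e\<^sup>2 / 2"
      using F(2) by (simp add: dist_real_def)
    then have "(norm (x - y))\<^sup>2 < e\<^sup>2"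
      using e by (smt (verit) half_gt_zero_iff field_sum_of_halves zero_less_power)
    then have "dist y x < e"
      using e by (simp add: dist_norm norm_minus_commute power2_less_imp_less)
    moreover have "y \<in> span {a \<otimes>\<^sub>2 h | a h. a \<in> ell2_on I}"
      unfolding y_def
      by (intro span_sum span_base) (auto simp: ell2_on_def basis_ell2.rep_eq)
    ultimately show "\<exists>y\<in>span {a \<otimes>\<^sub>2 h | a h. a \<in> ell2_on I}. dist y x < e"
      by blast
  qed
qed


section \<open>Operator-valued frames and frame generators\<close>

definition ov_frame :: "('j \<Rightarrow> 'h::complex_inner \<Rightarrow> 'k::complex_inner) \<Rightarrow> 'j set \<Rightarrow> bool"
  where "ov_frame A J \<longleftrightarrow> (\<forall>j\<in>J. bounded_clinear (A j)) \<and>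
    (\<exists>S. has_sot_sum (\<lambda>j. cadjoint (A j) \<circ> A j) S J \<and> positive_op S \<and> invertible_op S)"

definition parseval_ov_frame :: "('j \<Rightarrow> 'h::complex_inner \<Rightarrow> 'k::complex_inner) \<Rightarrow> 'j set \<Rightarrow> bool"
  where "parseval_ov_frame A J \<longleftrightarrow> ov_frame A J \<and> has_sot_sum (\<lambda>j. cadjoint (A j) \<circ> A j) id J"

definition unitary_system :: "('h::complex_inner \<Rightarrow> 'h) set \<Rightarrow> bool"
  where "unitary_system \<U> \<longleftrightarrow> id \<in> \<U> \<and> (\<forall>U\<in>\<U>. unitary_op U)"

definition frame_generator ::
    "('h::complex_inner \<Rightarrow> 'h) set \<Rightarrow> ('h \<Rightarrow> 'k::complex_inner) \<Rightarrow> bool"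
  where "frame_generator \<U> A \<longleftrightarrow> bounded_clinear A \<and> ov_frame (\<lambda>U. A \<circ> cadjoint U) \<U>"

definition parseval_frame_generator ::
    "('h::complex_inner \<Rightarrow> 'h) set \<Rightarrow> ('h \<Rightarrow> 'k::complex_inner) \<Rightarrow> bool"
  where "parseval_frame_generator \<U> A \<longleftrightarrow>
    bounded_clinear A \<and> parseval_ov_frame (\<lambda>U. A \<circ> cadjoint U) \<U>"

definition L_op :: "'i \<Rightarrow> 'k::complex_inner \<Rightarrow> ('i, 'k) ell2"
  where "L_op U h = basis_ell2 U \<otimes>\<^sub>2 h"

text \<open>
  The sum is taken pointwise, that is, in the strong operator topology; it converges for frame
  generators.  The analysis operator takes its values in \<^term>\<open>ell2_tensor \<U>\<close>.  Since that is a closed subspace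
  of the type \<open>ell2\<close>, the adjoint of the analysis operator as an operator into
  \<^term>\<open>ell2_tensor \<U>\<close> is the restriction of its \<^const>\<open>cadjoint\<close> to \<^term>\<open>ell2_tensor \<U>\<close>, and the
  identity of \<open>\<ell>\<^sup>2(\<U>) \<otimes> K\<close> is the identity on that set.
\<close>

definition analysis_op ::
    "('h::complex_inner \<Rightarrow> 'h) set \<Rightarrow> ('h \<Rightarrow> 'k::complex_inner) \<Rightarrow> 'h \<Rightarrow> ('h \<Rightarrow> 'h, 'k) ell2"
  where "analysis_op \<U> A x = (\<Sum>\<^sub>\<infinity>U\<in>\<U>. L_op U (A (cadjoint U x)))"

end

theory Submission
  imports Defs
begin

text \<open>
  Write \<open>\<theta>\<^sub>A\<close> for the analysis operator of \<open>A\<close>.  For a generator \<open>A\<close> with frame operator \<open>S\<close> one has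
  \<open>\<theta>\<^sub>A\<^sup>*\<theta>\<^sub>A = S\<close> (\<open>cadjoint_analysis_op_comp\<close>) and \<open>\<theta>\<^sub>A\<^sup>* (e\<^sub>U \<otimes> h) = U A\<^sup>* h\<close>
  (\<open>cadjoint_analysis_op_basis\<close>).  If moreover \<open>\<theta>\<^sub>A\<theta>\<^sub>A\<^sup>* = I\<close>, then \<open>\<theta>\<^sub>A S = \<theta>\<^sub>A\<close>, so \<open>S\<close> is an invertible
  idempotent; hence \<open>S = I\<close> and \<open>\<theta>\<^sub>A\<close> is unitary onto \<open>\<ell>\<^sup>2(\<U>) \<otimes> H\<^sub>o\<close>.

  Given a Parseval generator \<open>B\<close>, put \<open>V = \<theta>\<^sub>B\<^sup>*\<theta>\<^sub>A\<close>.  Then \<open>VV\<^sup>* = \<theta>\<^sub>B\<^sup>*\<theta>\<^sub>A\<theta>\<^sub>A\<^sup>*\<theta>\<^sub>B = \<theta>\<^sub>B\<^sup>*\<theta>\<^sub>B = I\<close>, and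
  \<open>VUA\<^sup>* h = \<theta>\<^sub>B\<^sup>*\<theta>\<^sub>A\<theta>\<^sub>A\<^sup>* (e\<^sub>U \<otimes> h) = UB\<^sup>* h\<close>; the case \<open>U = I\<close> gives \<open>VA\<^sup>* = B\<^sup>*\<close>, that is
  \<open>B = AV\<^sup>*\<close>, and then \<open>VUA\<^sup>* = UVA\<^sup>*\<close>.

  Conversely, if \<open>B = AV\<^sup>*\<close> and \<open>VUA\<^sup>* = UVA\<^sup>*\<close>, then \<open>UB\<^sup>* = VUA\<^sup>*\<close>, so that
  \<open>\<Sum> UB\<^sup>*BU\<^sup>* = V (\<Sum> UA\<^sup>*AU\<^sup>*) V\<^sup>* = VV\<^sup>* = I\<close>.  Taking adjoints, \<open>BU\<^sup>* = AU\<^sup>*V\<^sup>*\<close>, hence \<open>\<theta>\<^sub>B = \<theta>\<^sub>AV\<^sup>*\<close>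
  and \<open>\<theta>\<^sub>B\<^sup>*\<theta>\<^sub>A = V\<theta>\<^sub>A\<^sup>*\<theta>\<^sub>A = V\<close>.

  The existence of adjoints rests on the Riesz representation theorem, proved first.  All
  computations with adjoints use the real inner product, which determines the complex one.
\<close>


section \<open>Riesz representation\<close>

text \<open>
  The representing vector is the minimiser of \<open>\<phi> x = \<parallel>x\<parallel>\<^sup>2 - 2 f x\<close>: by the parallelogram law every
  minimising sequence is Cauchy, and the vanishing of the first variation at the minimiser \<open>z\<close>
  reads \<open>f x = \<langle>x, z\<rangle>\<close>.
\<close>

lemma riesz_representation:
  fixes f :: "'a::{real_inner,complete_space} \<Rightarrow> real"
  assumes "bounded_linear f"
  obtains z where "\<And>x. f x = inner x z"
proof -
  interpret f: bounded_linear f by fact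
  define \<phi> where "\<phi> x = (norm x)\<^sup>2 - 2 * f x" for x
  obtain K where K: "\<And>x. norm (f x) \<le> norm x * K"
    using f.bounded by blast
  \<comment> \<open>By completing the square, \<open>\<parallel>x\<parallel>\<^sup>2 - 2 K \<parallel>x\<parallel> \<ge> - K\<^sup>2\<close>.\<close>
  have low: "- K\<^sup>2 \<le> \<phi> x" for x
  proof -
    have "f x \<le> norm x * K"
      using K [of x] by simp
    moreover have "0 \<le> (norm x - K)\<^sup>2"
      by simp
    ultimately show ?thesis
      by (simp add: \<phi>_def power2_diff)
  qed
  define m where "m = (INF x. \<phi> x)"
  have bdd: "bdd_below (range \<phi>)"
    using low by (auto intro: bdd_belowI [where m = "- K\<^sup>2"])
  have m_le: "m \<le> \<phi> x" for x
    unfolding m_def by (rule cINF_lower [OF bdd]) simp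
  have "\<exists>x. \<phi> x < r" if "m < r" for r
    using that cINF_less_iff [OF _ bdd, of r] by (simp add: m_def)
  moreover have "m < m + inverse (real (Suc n))" for n
    by simp
  ultimately have "\<forall>n. \<exists>x. \<phi> x < m + inverse (real (Suc n))"
    by blast
  then obtain X where X: "\<And>n. \<phi> (X n) < m + inverse (real (Suc n))"
    by metis
  \<comment> \<open>The parallelogram law, with \<open>\<phi> \<ge> m\<close> applied at the midpoint.\<close>
  have dist_bound: "(norm (x - y))\<^sup>2 \<le> 2 * (\<phi> x - m) + 2 * (\<phi> y - m)" for x y
  proof -
    define w where "w = (1/2) *\<^sub>R (x + y)"
    have "(norm (x - y))\<^sup>2 = 2 * \<phi> x + 2 * \<phi> y - 4 * \<phi> w"
      by (simp add: w_def \<phi>_def power2_norm_eq_inner f.add f.scaleR inner_add_left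
          inner_add_right inner_diff_left inner_diff_right inner_commute field_simps)
    with m_le [of w] show ?thesis
      by (simp add: algebra_simps)
  qed
  have "Cauchy X"
  proof (rule metric_CauchyI)
    fix e :: real assume e: "e > 0"
    then obtain N where N: "inverse (real (Suc N)) < e\<^sup>2 / 4"
      using reals_Archimedean [of "e\<^sup>2 / 4"] by auto
    have close: "\<phi> (X k) - m < e\<^sup>2 / 4" if "k \<ge> N" for k
    proof -
      have "inverse (real (Suc k)) \<le> inverse (real (Suc N))"
        using that by (simp add: le_imp_inverse_le)
      then show ?thesis
        using X [of k] N by linarith
    qed
    have "dist (X i) (X j) < e" if "i \<ge> N" "j \<ge> N" for i j
    proof -
      have "(norm (X i - X j))\<^sup>2 < e\<^sup>2"
        using dist_bound [of "X i" "X j"] close [OF that(1)] close [OF that(2)] by argo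
      then show ?thesis
        using e by (simp add: dist_norm power2_less_imp_less)
    qed
    then show "\<exists>N. \<forall>i\<ge>N. \<forall>j\<ge>N. dist (X i) (X j) < e"
      by blast
  qed
  then obtain z where z: "X \<longlonglongrightarrow> z"
    using Cauchy_convergent convergent_def by blast
  have "(\<lambda>n. \<phi> (X n)) \<longlonglongrightarrow> \<phi> z"
    unfolding \<phi>_def by (intro tendsto_intros f.tendsto z)
  moreover have "(\<lambda>n. m + inverse (real (Suc n))) \<longlonglongrightarrow> m"
    using tendsto_add [OF tendsto_const LIMSEQ_inverse_real_of_nat] by simp
  ultimately have "\<phi> z \<le> m"
    by (rule LIMSEQ_le) (use X less_imp_le in blast)
  then have min: "\<phi> z \<le> \<phi> y" for y
    using m_le [of y] by linarith
  have "f x = inner x z" for x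
  proof (rule ccontr)
    assume neq: "f x \<noteq> inner x z"
    define d where "d = f x - inner x z"
    have x0: "inner x x > 0"
      using neq f.zero by (cases "x = 0") auto
    have "\<phi> (z + t *\<^sub>R x) = \<phi> z + (t\<^sup>2 * inner x x - 2 * t * d)" for t
      unfolding \<phi>_def d_def power2_norm_eq_inner
      by (simp add: f.add f.scaleR inner_add_left inner_add_right inner_commute
          power2_eq_square algebra_simps)
    then have var: "0 \<le> t\<^sup>2 * inner x x - 2 * t * d" for t
      using min [of "z + t *\<^sub>R x"] by simp
    \<comment> \<open>The quadratic in \<open>t\<close> is minimal at \<open>d / \<parallel>x\<parallel>\<^sup>2\<close>, with value \<open>- d\<^sup>2 / \<parallel>x\<parallel>\<^sup>2\<close>.\<close>
    have "(d / inner x x)\<^sup>2 * inner x x - 2 * (d / inner x x) * d = - (d\<^sup>2 / inner x x)"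
      using x0 by (simp add: field_simps power2_eq_square)
    then have "d\<^sup>2 / inner x x \<le> 0"
      using var [of "d / inner x x"] by linarith
    moreover have "d\<^sup>2 / inner x x > 0"
      using neq x0 by (simp add: d_def)
    ultimately show False
      by linarith
  qed
  then show thesis
    by (rule that)
qed


section \<open>Adjoints\<close>

lemma scaleC_zero_right [simp]: "c *\<^sub>C 0 = (0 :: 'a::complex_inner)"
  using norm_scaleC [of c "0 :: 'a"] by simp

lemma inner_scaleC_right: "inner x (c *\<^sub>C y) = inner (cnj c *\<^sub>C x) y" for x :: "'a::complex_inner"
  by (simp add: inner_eq_Re_cinner cinner_scaleC_left cinner_scaleC_right)

text \<open>
  For complex-linear operators it is enough to test adjointness with the real inner product, since
  the imaginary part of \<open>cinner x y\<close> is \<open>inner (- \<i> x) y\<close>.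
\<close>

lemma cadjoint_eqI_inner:
  fixes T :: "'a::complex_inner \<Rightarrow> 'b::complex_inner"
  assumes T: "bounded_clinear T" and S: "\<And>x y. inner (T x) y = inner x (S y)"
  shows "cadjoint T = S"
proof (rule cadjoint_eqI)
  fix x y
  have Im: "Im (cinner u v) = inner ((- \<i>) *\<^sub>C u) v" for u v :: "'c::complex_inner"
    by (simp add: inner_eq_Re_cinner cinner_scaleC_left)
  have "(- \<i>) *\<^sub>C T x = T ((- \<i>) *\<^sub>C x)"
    using T by (simp add: bounded_clinear_def)
  then have "Im (cinner (T x) y) = Im (cinner x (S y))"
    unfolding Im by (simp only: S)
  moreover have "Re (cinner (T x) y) = Re (cinner x (S y))"
    using S by (simp add: inner_eq_Re_cinner)
  ultimately show "cinner (T x) y = cinner x (S y)"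
    by (simp add: complex_eq_iff)
qed

lemma inner_cadjoint:
  fixes T :: "'a::chilbert_space \<Rightarrow> 'b::complex_inner"
  assumes T: "bounded_clinear T"
  shows "inner (T x) y = inner x (cadjoint T y)"
proof -
  have "\<exists>z. \<forall>x. inner (T x) y = inner x z" for y
  proof -
    have "bounded_linear (\<lambda>x. inner (T x) y)"
      using T bounded_linear_compose [OF bounded_linear_inner_left] by (auto simp: bounded_clinear_def)
    then show ?thesis
      by (metis riesz_representation)
  qed
  then obtain S where "\<And>x y. inner (T x) y = inner x (S y)"
    by metis
  with cadjoint_eqI_inner [OF T] show ?thesis
    by metis
qed

lemma bounded_clinear_cadjoint:
  fixes T :: "'a::chilbert_space \<Rightarrow> 'b::complex_inner"
  assumes T: "bounded_clinear T"
  shows "bounded_clinear (cadjoint T)"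
proof -
  note adj = inner_cadjoint [OF T, symmetric]
  interpret T: bounded_linear T
    using T by (simp add: bounded_clinear_def)
  obtain K where K0: "0 \<le> K" and K: "\<And>x. norm (T x) \<le> norm x * K"
    using T.nonneg_bounded by blast
  have bound: "norm (cadjoint T y) \<le> norm y * K" for y
  proof (cases "cadjoint T y = 0")
    case False
    have "norm (cadjoint T y) * norm (cadjoint T y) = inner (T (cadjoint T y)) y"
      by (simp add: inner_cadjoint [OF T] power2_norm_eq_inner flip: power2_eq_square)
    also have "\<dots> \<le> norm (T (cadjoint T y)) * norm y"
      by (rule norm_cauchy_schwarz)
    also have "\<dots> \<le> norm (cadjoint T y) * K * norm y"
      by (rule mult_right_mono [OF K]) simp
    finally show ?thesis
      using False by (simp add: mult.assoc mult.commute)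
  qed (use K0 in simp)
  have eqI: "u = v" if "\<And>x. inner x u = inner x v" for u v :: 'a
    using that by (metis vector_eq_ldot)
  have "bounded_linear (cadjoint T)"
  proof (rule bounded_linear_intro [OF _ _ bound])
    show "cadjoint T (x + y) = cadjoint T x + cadjoint T y" for x y
      by (rule eqI) (simp add: adj inner_add_right)
    show "cadjoint T (r *\<^sub>R x) = r *\<^sub>R cadjoint T x" for r x
      by (rule eqI) (simp add: adj)
  qed
  moreover have "cadjoint T (c *\<^sub>C y) = c *\<^sub>C cadjoint T y" for c y
  proof (rule eqI)
    have "T (cnj c *\<^sub>C x) = cnj c *\<^sub>C T x" for x
      using T by (simp add: bounded_clinear_def)
    then show "inner x (cadjoint T (c *\<^sub>C y)) = inner x (c *\<^sub>C cadjoint T y)" for x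
      by (simp add: adj inner_scaleC_right)
  qed
  ultimately show ?thesis
    by (simp add: bounded_clinear_def)
qed

lemma bounded_clinear_comp:
  "bounded_clinear S \<Longrightarrow> bounded_clinear T \<Longrightarrow> bounded_clinear (S \<circ> T)"
  by (simp add: bounded_clinear_def comp_def bounded_linear_compose)

lemma bounded_clinear_id: "bounded_clinear id"
  by (simp add: bounded_clinear_def id_def bounded_linear_ident)

lemma inner_cadjoint_left:
  fixes T :: "'a::chilbert_space \<Rightarrow> 'b::complex_inner"
  assumes "bounded_clinear T"
  shows "inner (cadjoint T y) x = inner y (T x)"
  using inner_cadjoint [OF assms, of x y] by (simp add: inner_commute)

lemma cadjoint_cadjoint:
  fixes T :: "'a::chilbert_space \<Rightarrow> 'b::complex_inner"
  assumes "bounded_clinear T"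
  shows "cadjoint (cadjoint T) = T"
  by (rule cadjoint_eqI_inner)
     (simp_all add: assms bounded_clinear_cadjoint inner_cadjoint_left)

lemma cadjoint_comp:
  fixes S :: "'b::chilbert_space \<Rightarrow> 'c::complex_inner" and T :: "'a::chilbert_space \<Rightarrow> 'b"
  assumes "bounded_clinear S" "bounded_clinear T"
  shows "cadjoint (S \<circ> T) = cadjoint T \<circ> cadjoint S"
  by (rule cadjoint_eqI_inner) (use assms in \<open>simp_all add: bounded_clinear_comp inner_cadjoint\<close>)


section \<open>Expansion in the standard basis\<close>

lemma inner_basis_tensor:
  "inner x (basis_ell2 i \<otimes>\<^sub>2 h) = inner (ell2_apply x i) h"
proof -
  have "inner x (basis_ell2 i \<otimes>\<^sub>2 h)
      = (\<Sum>\<^sub>\<infinity>j\<in>{i}. inner (ell2_apply x j) (ell2_apply (basis_ell2 i \<otimes>\<^sub>2 h) j))"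
    unfolding inner_ell2.rep_eq
    by (rule infsum_cong_neutral) (auto simp: tensor.rep_eq basis_ell2.rep_eq)
  then show ?thesis
    by (simp add: tensor.rep_eq basis_ell2.rep_eq)
qed

text \<open>
  The squared distance of \<open>x\<close> from its partial expansion over a finite set \<open>F\<close> is \<open>\<parallel>x\<parallel>\<^sup>2\<close> minus the sum
  of the squared norms of the coordinates of \<open>x\<close> in \<open>F\<close>.
\<close>

lemma ell2_has_sum_basis:
  "((\<lambda>i. basis_ell2 i \<otimes>\<^sub>2 ell2_apply x i) has_sum x) UNIV"
proof -
  define p where "p F = (\<Sum>i\<in>F. basis_ell2 i \<otimes>\<^sub>2 ell2_apply x i)" for F
  define s where "s F = (\<Sum>i\<in>F. (norm (ell2_apply x i))\<^sup>2)" for F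
  have inner_p: "inner y (p F) = (\<Sum>i\<in>F. inner (ell2_apply y i) (ell2_apply x i))" for y F
    by (simp add: p_def inner_sum_right inner_basis_tensor)
  have norm_diff: "norm (p F - x) = sqrt ((norm x)\<^sup>2 - s F)" if "finite F" for F
  proof -
    have "inner x (p F) = s F"
      by (simp add: inner_p s_def power2_norm_eq_inner)
    moreover have "inner (p F) (p F) = s F"
      unfolding inner_p s_def power2_norm_eq_inner
      by (rule sum.cong) (simp_all add: p_def ell2_apply_basis_sum that)
    ultimately have "(norm (p F - x))\<^sup>2 = (norm x)\<^sup>2 - s F"
      by (simp add: power2_norm_eq_inner inner_diff_left inner_diff_right inner_commute)
    then show ?thesis
      by (metis norm_ge_zero real_sqrt_unique)
  qed
  have "((\<lambda>i. (norm (ell2_apply x i))\<^sup>2) has_sum (norm x)\<^sup>2) UNIV"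
    unfolding norm_ell2_sq using ell2_apply_summable by (rule has_sum_infsum)
  then have "(s \<longlongrightarrow> (norm x)\<^sup>2) (finite_subsets_at_top UNIV)"
    by (simp add: has_sum_def s_def [abs_def])
  then have "((\<lambda>F. sqrt ((norm x)\<^sup>2 - s F)) \<longlongrightarrow> sqrt ((norm x)\<^sup>2 - (norm x)\<^sup>2))
      (finite_subsets_at_top UNIV)"
    by (intro tendsto_intros)
  moreover have "\<forall>\<^sub>F F in finite_subsets_at_top UNIV. sqrt ((norm x)\<^sup>2 - s F) = norm (p F - x)"
    by (rule eventually_finite_subsets_at_top_weakI) (simp add: norm_diff)
  ultimately have "((\<lambda>F. norm (p F - x)) \<longlongrightarrow> 0) (finite_subsets_at_top UNIV)"
    using Lim_transform_eventually by fastforce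
  then have "(p \<longlongrightarrow> x) (finite_subsets_at_top UNIV)"
    by (simp add: tendsto_norm_zero_iff LIM_zero_iff)
  then show ?thesis
    by (simp add: has_sum_def p_def [abs_def])
qed


section \<open>Analysis operators\<close>

lemma inner_has_sum_left:
  assumes "(f has_sum x) J"
  shows "((\<lambda>j. inner (f j) y) has_sum inner x y) J"
  using has_sum_bounded_linear [OF bounded_linear_inner_left assms] by (simp add: o_def)

text \<open>
  Throughout, \<open>S\<close> is the frame operator \<open>\<Sum> U A\<^sup>* A U\<^sup>*\<close> of \<open>A\<close>, the sum being taken over \<open>U \<in> \<U>\<close>.
\<close>

context
  fixes \<U> :: "('h::chilbert_space \<Rightarrow> 'h) set" and A :: "'h \<Rightarrow> 'k::chilbert_space" and S
  assumes unitary: "unitary_system \<U>"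
    and A: "bounded_clinear A"
    and S: "bounded_clinear S"
    and S_sum: "has_sot_sum (\<lambda>U. cadjoint (A \<circ> cadjoint U) \<circ> (A \<circ> cadjoint U)) S \<U>"
begin

lemma bounded_clinear_member: "U \<in> \<U> \<Longrightarrow> bounded_clinear U"
  using unitary by (simp add: unitary_system_def unitary_op_def)

lemma bounded_clinear_frame_entry: "U \<in> \<U> \<Longrightarrow> bounded_clinear (A \<circ> cadjoint U)"
  by (intro bounded_clinear_comp A bounded_clinear_cadjoint bounded_clinear_member)

lemma frame_has_sum_inner:
  "((\<lambda>U. inner (A (cadjoint U x)) (A (cadjoint U y))) has_sum inner (S x) y) \<U>"
proof -
  have "((\<lambda>U. inner (cadjoint (A \<circ> cadjoint U) (A (cadjoint U x))) y) has_sum inner (S x) y) \<U>"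
    using S_sum by (intro inner_has_sum_left) (simp add: has_sot_sum_def)
  moreover have "inner (cadjoint (A \<circ> cadjoint U) (A (cadjoint U x))) y
      = inner (A (cadjoint U x)) (A (cadjoint U y))" if "U \<in> \<U>" for U
  proof -
    have "bounded_clinear (A \<circ> cadjoint U)"
      using that by (rule bounded_clinear_frame_entry)
    then show ?thesis
      by (simp add: inner_cadjoint_left)
  qed
  ultimately show ?thesis
    by (rule has_sum_cong [THEN iffD1, rotated])
qed

text \<open>
  The unconditional sum defining the analysis operator converges, and its \<open>U\<close>-th coordinate is
  \<open>A U\<^sup>* x\<close>: the family of these vectors is square-summable because the squares of its norms sum to
  \<open>\<langle>S x, x\<rangle>\<close>, and every square-summable family is the sum of its expansion in the standard basis.
\<close>

lemma ell2_apply_analysis_op: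
  "ell2_apply (analysis_op \<U> A x) U = (if U \<in> \<U> then A (cadjoint U x) else 0)"
proof -
  define f where "f U = (if U \<in> \<U> then A (cadjoint U x) else 0)" for U
  have "((\<lambda>U. (norm (f U))\<^sup>2) has_sum inner (S x) x) UNIV"
    by (rule has_sum_cong_neutral [THEN iffD1, rotated 3, OF frame_has_sum_inner])
       (auto simp: f_def power2_norm_eq_inner)
  then have "(\<lambda>U. (norm (f U))\<^sup>2) summable_on UNIV"
    by (rule has_sum_imp_summable)
  then have app: "ell2_apply (Abs_ell2 f) = f"
    by (simp add: Abs_ell2_inverse)
  have "((\<lambda>U. L_op U (A (cadjoint U x))) has_sum Abs_ell2 f) \<U>"
    by (rule has_sum_cong_neutral [THEN iffD1, rotated 3, OF ell2_has_sum_basis])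
       (auto simp: L_op_def app f_def tensor.rep_eq zero_ell2.rep_eq intro: ell2_eqI)
  then have "analysis_op \<U> A x = Abs_ell2 f"
    unfolding analysis_op_def by (rule infsumI)
  then show ?thesis
    by (simp add: app f_def)
qed

lemma inner_analysis_op: "inner (analysis_op \<U> A x) (analysis_op \<U> A y) = inner (S x) y"
proof -
  have "((\<lambda>U. inner (ell2_apply (analysis_op \<U> A x) U) (ell2_apply (analysis_op \<U> A y) U))
      has_sum inner (S x) y) UNIV"
    by (rule has_sum_cong_neutral [THEN iffD1, rotated 3, OF frame_has_sum_inner])
       (auto simp: ell2_apply_analysis_op)
  then show ?thesis
    unfolding inner_ell2.rep_eq by (rule infsumI)
qed

lemma analysis_op_in_ell2_tensor: "analysis_op \<U> A x \<in> ell2_tensor \<U>"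
  by (simp add: ell2_tensor_eq ell2_apply_analysis_op)

lemma bounded_clinear_analysis_op: "bounded_clinear (analysis_op \<U> A)"
proof -
  have comp: "bounded_linear (\<lambda>x. A (cadjoint U x))"
      "A (cadjoint U (c *\<^sub>C x)) = c *\<^sub>C A (cadjoint U x)" if "U \<in> \<U>" for U c x
  proof -
    have "bounded_clinear (A \<circ> cadjoint U)"
      using that by (rule bounded_clinear_frame_entry)
    then show "bounded_linear (\<lambda>x. A (cadjoint U x))"
        "A (cadjoint U (c *\<^sub>C x)) = c *\<^sub>C A (cadjoint U x)"
      by (simp_all add: bounded_clinear_def o_def)
  qed
  note lin = linear_add [OF bounded_linear.linear [OF comp(1)]]
    linear_scale [OF bounded_linear.linear [OF comp(1)]]
  obtain K where K: "K \<ge> 0" "\<And>x. norm (S x) \<le> norm x * K"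
    using S bounded_linear.nonneg_bounded unfolding bounded_clinear_def by blast
  have "bounded_linear (analysis_op \<U> A)"
  proof (rule bounded_linear_intro)
    show "analysis_op \<U> A (x + y) = analysis_op \<U> A x + analysis_op \<U> A y" for x y
      by (rule ell2_eqI) (simp add: ell2_apply_analysis_op plus_ell2.rep_eq lin)
    show "analysis_op \<U> A (r *\<^sub>R x) = r *\<^sub>R analysis_op \<U> A x" for r x
      by (rule ell2_eqI) (simp add: ell2_apply_analysis_op scaleR_ell2.rep_eq lin)
    show "norm (analysis_op \<U> A x) \<le> norm x * sqrt K" for x
    proof -
      have "(norm (analysis_op \<U> A x))\<^sup>2 = inner (S x) x"
        by (simp add: power2_norm_eq_inner inner_analysis_op)
      also have "\<dots> \<le> norm (S x) * norm x"
        by (rule norm_cauchy_schwarz)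
      also have "\<dots> \<le> norm x * K * norm x"
        by (rule mult_right_mono [OF K(2)]) simp
      also have "\<dots> = (norm x * sqrt K)\<^sup>2"
        using K(1) by (simp add: power_mult_distrib power2_eq_square)
      finally show ?thesis
        by (rule power2_le_imp_le) (simp add: K(1))
    qed
  qed
  moreover have "analysis_op \<U> A (c *\<^sub>C x) = c *\<^sub>C analysis_op \<U> A x" for c x
    by (rule ell2_eqI) (simp add: ell2_apply_analysis_op scaleC_ell2.rep_eq comp(2))
  ultimately show ?thesis
    by (simp add: bounded_clinear_def)
qed

lemma cadjoint_analysis_op_comp: "cadjoint (analysis_op \<U> A) (analysis_op \<U> A x) = S x"
proof -
  have "inner (cadjoint (analysis_op \<U> A) (analysis_op \<U> A x)) y = inner (S x) y" for y
    by (simp add: inner_cadjoint_left bounded_clinear_analysis_op inner_analysis_op)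
  then show ?thesis
    by (metis vector_eq_rdot)
qed

lemma cadjoint_analysis_op_basis:
  assumes U: "U \<in> \<U>"
  shows "cadjoint (analysis_op \<U> A) (L_op U h) = U (cadjoint A h)"
proof -
  have cU: "bounded_clinear U"
    using U by (rule bounded_clinear_member)
  have "inner y (cadjoint (analysis_op \<U> A) (L_op U h)) = inner y (U (cadjoint A h))" for y
  proof -
    have "inner y (cadjoint (analysis_op \<U> A) (L_op U h)) = inner (analysis_op \<U> A y) (L_op U h)"
      by (simp add: inner_cadjoint bounded_clinear_analysis_op)
    also have "\<dots> = inner (A (cadjoint U y)) h"
      using U by (simp add: L_op_def inner_basis_tensor ell2_apply_analysis_op)
    also have "\<dots> = inner y (U (cadjoint A h))"
      by (simp add: inner_cadjoint A inner_cadjoint_left cU)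
    finally show ?thesis .
  qed
  then show ?thesis
    by (metis vector_eq_ldot)
qed

end


section \<open>Parseval frame generators and co-isometries\<close>

theorem proposition6p2:
  fixes \<U> :: "('h::chilbert_space \<Rightarrow> 'h) set"
    and A B :: "'h \<Rightarrow> 'k::chilbert_space"
  assumes "unitary_system \<U>"
    and "frame_generator \<U> A"
    and "\<forall>x\<in>ell2_tensor \<U>. analysis_op \<U> A (cadjoint (analysis_op \<U> A) x) = x"
    and "bounded_clinear B"
  shows "(parseval_frame_generator \<U> B \<longleftrightarrow>
            (\<exists>V. coisometry V
                \<and> (\<forall>U\<in>\<U>. (\<lambda>x. V (U x) - U (V x)) \<circ> cadjoint A = (\<lambda>_. 0))
                \<and> B = A \<circ> cadjoint V))
       \<and> (\<forall>V. coisometry V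
                \<and> (\<forall>U\<in>\<U>. (\<lambda>x. V (U x) - U (V x)) \<circ> cadjoint A = (\<lambda>_. 0))
                \<and> B = A \<circ> cadjoint V
              \<longrightarrow> V = cadjoint (analysis_op \<U> B) \<circ> analysis_op \<U> A)"
proof -
  let ?\<theta>A = "analysis_op \<U> A" and ?\<theta>B = "analysis_op \<U> B"
  have A: "bounded_clinear A"
    using assms(2) by (simp add: frame_generator_def)
  have cU: "bounded_clinear U" if "U \<in> \<U>" for U
    using assms(1) that by (simp add: unitary_system_def unitary_op_def)
  obtain S where S: "bounded_clinear S" "invertible_op S"
    "has_sot_sum (\<lambda>U. cadjoint (A \<circ> cadjoint U) \<circ> (A \<circ> cadjoint U)) S \<U>"
    using assms(2) unfolding frame_generator_def ov_frame_def invertible_op_def by blast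
  note fA = assms(1) A S(1) S(3)
  note clA = bounded_clinear_analysis_op [OF fA]
  \<comment> \<open>\<open>\<theta>\<^sub>A S = \<theta>\<^sub>A\<theta>\<^sub>A\<^sup>*\<theta>\<^sub>A = \<theta>\<^sub>A\<close> makes \<open>S\<close> idempotent, and \<open>S\<close> is invertible.\<close>
  have S_id: "S x = x" for x
  proof -
    have "?\<theta>A (S x) = ?\<theta>A x"
      using assms(3) analysis_op_in_ell2_tensor [OF fA, of x] cadjoint_analysis_op_comp [OF fA, of x]
      by metis
    then have "S (S x) = S x"
      using cadjoint_analysis_op_comp [OF fA] by metis
    then show ?thesis
      using S(2) unfolding invertible_op_def by (metis comp_apply id_apply)
  qed
  then have isoA: "cadjoint ?\<theta>A (?\<theta>A x) = x" for x
    using cadjoint_analysis_op_comp [OF fA] by simp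
  have B_adjoint: "V (U (cadjoint A h)) = U (cadjoint B h)"
    if V: "coisometry V" and comm: "\<forall>U\<in>\<U>. (\<lambda>x. V (U x) - U (V x)) \<circ> cadjoint A = (\<lambda>_. 0)"
      and B: "B = A \<circ> cadjoint V" and U: "U \<in> \<U>" for V U h
  proof -
    have "bounded_clinear V"
      using V by (simp add: coisometry_def)
    then have "cadjoint B = V \<circ> cadjoint A"
      unfolding B by (simp add: cadjoint_comp A bounded_clinear_cadjoint cadjoint_cadjoint)
    moreover have "V (U (cadjoint A h)) - U (V (cadjoint A h)) = 0"
      using comm U by (metis comp_apply)
    ultimately show ?thesis
      by simp
  qed
  have B_entry: "B (cadjoint U x) = A (cadjoint U (cadjoint V x))"
    if V: "coisometry V" and comm: "\<forall>U\<in>\<U>. (\<lambda>x. V (U x) - U (V x)) \<circ> cadjoint A = (\<lambda>_. 0)"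
      and B: "B = A \<circ> cadjoint V" and U: "U \<in> \<U>" for V U x
  proof -
    have cV: "bounded_clinear V"
      using V by (simp add: coisometry_def)
    have "inner (B (cadjoint U x)) h = inner (A (cadjoint U (cadjoint V x))) h" for h
    proof -
      have "inner (B (cadjoint U x)) h = inner x (U (cadjoint B h))"
        by (simp add: inner_cadjoint assms(4) inner_cadjoint_left cU U)
      also have "\<dots> = inner x (V (U (cadjoint A h)))"
        by (simp add: B_adjoint [OF that])
      also have "\<dots> = inner (A (cadjoint U (cadjoint V x))) h"
        by (simp add: inner_cadjoint A inner_cadjoint_left cU U cV)
      finally show ?thesis .
    qed
    then show ?thesis
      by (metis vector_eq_rdot)
  qed
  have necessity: "\<exists>V. coisometry V \<and> (\<forall>U\<in>\<U>. (\<lambda>x. V (U x) - U (V x)) \<circ> cadjoint A = (\<lambda>_. 0))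
      \<and> B = A \<circ> cadjoint V" if "parseval_frame_generator \<U> B"
  proof -
    have "has_sot_sum (\<lambda>U. cadjoint (B \<circ> cadjoint U) \<circ> (B \<circ> cadjoint U)) id \<U>"
      using that by (simp add: parseval_frame_generator_def parseval_ov_frame_def)
    note fB = assms(1,4) bounded_clinear_id this
    note clB = bounded_clinear_analysis_op [OF fB]
    define V where "V = cadjoint ?\<theta>B \<circ> ?\<theta>A"
    have V_apply: "V x = cadjoint ?\<theta>B (?\<theta>A x)" for x
      by (simp add: V_def)
    have cV: "bounded_clinear V"
      unfolding V_def by (intro bounded_clinear_comp bounded_clinear_cadjoint clA clB)
    have adjV: "cadjoint V = cadjoint ?\<theta>A \<circ> ?\<theta>B"
      by (simp add: V_def cadjoint_comp clA clB bounded_clinear_cadjoint cadjoint_cadjoint)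
    have "V (cadjoint V x) = x" for x
      using assms(3) analysis_op_in_ell2_tensor [OF fB] cadjoint_analysis_op_comp [OF fB]
      by (simp add: adjV V_apply)
    then have co: "coisometry V"
      by (auto simp: coisometry_def cV)
    have VU: "V (U (cadjoint A h)) = U (cadjoint B h)" if U: "U \<in> \<U>" for U h
    proof -
      have "L_op U h \<in> ell2_tensor \<U>"
        using U by (auto simp: L_op_def ell2_tensor_eq tensor.rep_eq basis_ell2.rep_eq)
      then show ?thesis
        using assms(3) by (simp add: V_def cadjoint_analysis_op_basis [OF fB U]
            flip: cadjoint_analysis_op_basis [OF fA U])
    qed
    have VA: "V (cadjoint A h) = cadjoint B h" for h
      using VU [of id h] assms(1) by (simp add: unitary_system_def)
    have "cadjoint B = V \<circ> cadjoint A"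
      using VA by auto
    then have "cadjoint (cadjoint B) = A \<circ> cadjoint V"
      by (simp add: cadjoint_comp cV A bounded_clinear_cadjoint cadjoint_cadjoint)
    then have "B = A \<circ> cadjoint V"
      by (simp add: cadjoint_cadjoint assms(4))
    with co show ?thesis
      by (intro exI [of _ V]) (auto simp: VU VA)
  qed
  have sufficiency: "parseval_frame_generator \<U> B"
    if V: "coisometry V" and comm: "\<forall>U\<in>\<U>. (\<lambda>x. V (U x) - U (V x)) \<circ> cadjoint A = (\<lambda>_. 0)"
      and B: "B = A \<circ> cadjoint V" for V
  proof -
    have cV: "bounded_clinear V"
      using V by (simp add: coisometry_def)
    have clBU: "bounded_clinear (B \<circ> cadjoint U)" if "U \<in> \<U>" for U
      using that by (intro bounded_clinear_comp assms(4) bounded_clinear_cadjoint cU)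
    have "has_sot_sum (\<lambda>U. cadjoint (B \<circ> cadjoint U) \<circ> (B \<circ> cadjoint U)) id \<U>"
      unfolding has_sot_sum_def
    proof
      fix x
      have "((\<lambda>U. cadjoint (A \<circ> cadjoint U) (A (cadjoint U (cadjoint V x))))
          has_sum cadjoint V x) \<U>"
        using S(3) S_id by (simp add: has_sot_sum_def)
      then have "((\<lambda>U. V (cadjoint (A \<circ> cadjoint U) (A (cadjoint U (cadjoint V x)))))
          has_sum V (cadjoint V x)) \<U>"
        using has_sum_bounded_linear cV unfolding bounded_clinear_def o_def by blast
      moreover have "V (cadjoint V x) = id x"
        using V by (metis coisometry_def comp_apply)
      moreover have "V (cadjoint (A \<circ> cadjoint U) (A (cadjoint U (cadjoint V x))))
          = (cadjoint (B \<circ> cadjoint U) \<circ> (B \<circ> cadjoint U)) x" if U: "U \<in> \<U>" for U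
        by (simp add: cadjoint_comp A assms(4) cU U bounded_clinear_cadjoint cadjoint_cadjoint
            B_entry [OF V comm B U] B_adjoint [OF V comm B U])
      ultimately show "((\<lambda>U. (cadjoint (B \<circ> cadjoint U) \<circ> (B \<circ> cadjoint U)) x) has_sum id x) \<U>"
        by (metis (no_types, lifting) has_sum_cong)
    qed
    moreover have "positive_op (id :: 'h \<Rightarrow> 'h)"
      by (simp add: positive_op_def bounded_clinear_id cinner_self)
    moreover have "invertible_op (id :: 'h \<Rightarrow> 'h)"
      unfolding invertible_op_def using bounded_clinear_id by auto
    ultimately show ?thesis
      unfolding parseval_frame_generator_def parseval_ov_frame_def ov_frame_def
      using assms(4) clBU by blast
  qed
  have uniqueness: "V = cadjoint ?\<theta>B \<circ> ?\<theta>A"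
    if V: "coisometry V" and comm: "\<forall>U\<in>\<U>. (\<lambda>x. V (U x) - U (V x)) \<circ> cadjoint A = (\<lambda>_. 0)"
      and B: "B = A \<circ> cadjoint V" for V
  proof -
    have cV: "bounded_clinear V"
      using V by (simp add: coisometry_def)
    have "?\<theta>B x = ?\<theta>A (cadjoint V x)" for x
      unfolding analysis_op_def by (rule infsum_cong) (simp add: B_entry [OF V comm B])
    then have "?\<theta>B = ?\<theta>A \<circ> cadjoint V"
      by auto
    then have "cadjoint ?\<theta>B = V \<circ> cadjoint ?\<theta>A"
      by (simp add: cadjoint_comp clA cV bounded_clinear_cadjoint cadjoint_cadjoint)
    then show ?thesis
      using isoA by auto
  qed
  show ?thesis
    using necessity sufficiency uniqueness by blast
qed

end
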